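(* Let $\Lambda$ be a lattice, $A$ an abelian group, and $f\colon\Lambda\to A$ any function. Then $\mathrm{Ann}(f)=\{s\in\mathrm{Sh}(\Lambda)\mid s\cdot f\equiv0\}$ is an ideal in $\mathrm{Sh}(\Lambda)$, and the quotient $K_f:=\mathrm{Sh}(\Lambda)/\mathrm{Ann}(f)$ has a Frobenius duality (with values in $A$) defined by the function \[ \ell_f\colon\mathrm{Sh}(\Lambda)\to A,\qquad \ell_f(t)=(t\cdot f)(0). \] Moreover, if $R$ is a commutative ring generated by invertible elements $a_1,\ldots,a_s\in R^\times$ with Frobenius duality given by a function $\ell\colon R\to A$, then $R\simeq K_f$ with \[ f\colon\mathbb{Z}^s\to A,\qquad f(n_1,\dots,n_s)=\ell(a_1^{n_1}\cdots a_s^{n_s}). \]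
   Context: A lattice is a free abelian group, possibly of infinite rank. $\mathrm{Sh}(\Lambda)=\mathbb{Z}[\Lambda]$ is the group ring, acting on functions $f\colon\Lambda\to A$ by $(t\cdot f)(x)=\sum_ia_if(x+\lambda_i)$ for $t=\sum_ia_i\lambda_i$, $a_i\in\mathbb{Z}$, $\lambda_i\in\Lambda$. For a commutative ring $R$ and a homomorphism of abelian groups $\ell\colon R\to A$, the $A$-valued pairing $\langle x,y\rangle_\ell=\ell(xy)$ on $R$ is a Frobenius duality if it is non-degenerate: for any $0\ne x\in R$ there is $y\in R$ with $\langle x,y\rangle_\ell\neq0$. *)

theory Defs
  imports "HOL-Algebra.Algebra"
begin

text \<open>Abelian groups are HOL-Algebra \<open>comm_group\<close> records, so their addition is written
  multiplicatively: \<open>x + y\<close> is \<open>x \<otimes> y\<close>, \<open>0\<close> is \<open>\<one>\<close>, and the integer multiple \<open>n x\<close> is \<open>x [^] n\<close>.\<close>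

text \<open>A basis can always be labelled by its own elements, so letting \<open>S\<close> range over sets in the
  type of the group is no restriction on the rank.\<close>

definition free_abelian_lattice :: "('l, 'm) monoid_scheme \<Rightarrow> bool" where
  "free_abelian_lattice \<Lambda> \<longleftrightarrow> comm_group \<Lambda> \<and> (\<exists>S :: 'l set. free_Abelian_group S \<cong> \<Lambda>)"

text \<open>Elements of the integral group ring are the finitely supported functions to the integers with
  support in the carrier; the product is the bilinear extension of the group law.\<close>

definition Sh :: "('l, 'm) monoid_scheme \<Rightarrow> ('l \<Rightarrow>\<^sub>0 int) ring" where
  "Sh \<Lambda> = \<lparr>carrier = {t. Poly_Mapping.keys t \<subseteq> carrier \<Lambda>},
     monoid.mult = (\<lambda>s t. frag_extend (\<lambda>p. frag_extend (\<lambda>q. frag_of (p \<otimes>\<^bsub>\<Lambda>\<^esub> q)) t) s),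
     one = frag_of \<one>\<^bsub>\<Lambda>\<^esub>, ring.zero = 0, ring.add = (+)\<rparr>"

definition shift_act ::
  "('l, 'm) monoid_scheme \<Rightarrow> ('a, 'n) monoid_scheme \<Rightarrow> ('l \<Rightarrow>\<^sub>0 int) \<Rightarrow> ('l \<Rightarrow> 'a) \<Rightarrow> 'l \<Rightarrow> 'a" where
  "shift_act \<Lambda> A t f x =
     (\<Otimes>\<^bsub>A\<^esub>l\<in>Poly_Mapping.keys t. f (x \<otimes>\<^bsub>\<Lambda>\<^esub> l) [^]\<^bsub>A\<^esub> Poly_Mapping.lookup t l)"

definition Ann ::
  "('l, 'm) monoid_scheme \<Rightarrow> ('a, 'n) monoid_scheme \<Rightarrow> ('l \<Rightarrow> 'a) \<Rightarrow> ('l \<Rightarrow>\<^sub>0 int) set" where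
  "Ann \<Lambda> A f = {s \<in> carrier (Sh \<Lambda>). \<forall>x\<in>carrier \<Lambda>. shift_act \<Lambda> A s f x = \<one>\<^bsub>A\<^esub>}"

definition K_quot ::
  "('l, 'm) monoid_scheme \<Rightarrow> ('a, 'n) monoid_scheme \<Rightarrow> ('l \<Rightarrow> 'a) \<Rightarrow> ('l \<Rightarrow>\<^sub>0 int) set ring" where
  "K_quot \<Lambda> A f = Sh \<Lambda> Quot Ann \<Lambda> A f"

definition ell ::
  "('l, 'm) monoid_scheme \<Rightarrow> ('a, 'n) monoid_scheme \<Rightarrow> ('l \<Rightarrow> 'a) \<Rightarrow> ('l \<Rightarrow>\<^sub>0 int) \<Rightarrow> 'a" where
  "ell \<Lambda> A f t = shift_act \<Lambda> A t f \<one>\<^bsub>\<Lambda>\<^esub>"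

definition frobenius_duality ::
  "('r, 'k) ring_scheme \<Rightarrow> ('a, 'n) monoid_scheme \<Rightarrow> ('r \<Rightarrow> 'a) \<Rightarrow> bool" where
  "frobenius_duality R A L \<longleftrightarrow> cring R \<and> comm_group A \<and> L \<in> hom (add_monoid R) A \<and>
     (\<forall>x\<in>carrier R. x \<noteq> \<zero>\<^bsub>R\<^esub> \<longrightarrow> (\<exists>y\<in>carrier R. L (x \<otimes>\<^bsub>R\<^esub> y) \<noteq> \<one>\<^bsub>A\<^esub>))"

text \<open>The lattice of integer \<open>s\<close>-tuples: \<open>Poly_Mapping.lookup n i\<close> is the \<open>i\<close>-th coordinate.\<close>

abbreviation Zpow :: "nat \<Rightarrow> (nat \<Rightarrow>\<^sub>0 int) monoid" where
  "Zpow s \<equiv> free_Abelian_group {1..s}"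

definition monomial_function ::
  "('r, 'k) ring_scheme \<Rightarrow> nat \<Rightarrow> (nat \<Rightarrow> 'r) \<Rightarrow> ('r \<Rightarrow> 'a) \<Rightarrow> (nat \<Rightarrow>\<^sub>0 int) \<Rightarrow> 'a" where
  "monomial_function R s a L n = L (\<Otimes>\<^bsub>R\<^esub>i\<in>{1..s}. a i [^]\<^bsub>R\<^esub> Poly_Mapping.lookup n i)"

end

theory Submission
  imports Defs
begin

text \<open>
  Everything rests on the linear extension \<open>t \<mapsto> \<Sum>\<^sub>l t\<^sub>l g(l)\<close> of a function \<open>g\<close> from a set
  to an abelian group: it is the unique homomorphism on the free abelian group that extends \<open>g\<close>,
  so identities between such extensions need only be checked on generators. Evaluating
  \<open>s \<cdot> f\<close> at \<open>x\<close> is the linear extension of \<open>l \<mapsto> f(x + l)\<close>, and checking on generators gives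
  \<open>(s t) \<cdot> f = s \<cdot> (t \<cdot> f)\<close> (\<open>shift_act_mult\<close>). Since \<open>Sh(\<Lambda>)\<close> is commutative, \<open>Ann(f)\<close> is
  therefore a two-sided ideal.

  The map \<open>\<ell>\<^sub>f\<close> vanishes on \<open>Ann(f)\<close>, hence descends to \<open>K\<^sub>f\<close>. The pairing is non-degenerate because
  \<open>\<ell>\<^sub>f(t x) = (t \<cdot> f)(x)\<close> for a lattice element \<open>x\<close> (\<open>ell_mult_of\<close>): if \<open>t\<close> is not in \<open>Ann(f)\<close>, some
  \<open>x\<close> makes the right-hand side non-zero.

  For the converse, let \<open>\<chi>(n)\<close> be the Laurent monomial with exponents \<open>n\<close> in the given units. It is
  multiplicative in \<open>n\<close>, so its linear extension \<open>h\<close> is a ring homomorphism from the group ring of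
  \<open>\<int>\<^sup>s\<close> to \<open>R\<close>; its image is a subring containing the generators, so \<open>h\<close> is onto. With
  \<open>f = \<ell> \<circ> \<chi>\<close> one has \<open>(t \<cdot> f)(n) = \<ell>(\<chi>(n) h(t))\<close> (\<open>shift_act_laurent_monomial\<close>). As the elements
  \<open>\<chi>(n)\<close> span \<open>R\<close> additively, non-degeneracy says that this vanishes for all \<open>n\<close> exactly
  when \<open>h(t) = 0\<close>. So \<open>Ann(f)\<close> is the kernel of \<open>h\<close> (\<open>kernel_monomial_eval\<close>), and the first isomorphism
  theorem concludes.
\<close>

section \<open>Linear extension of a function to formal integer combinations\<close>

text \<open>The linear extension of \<open>g\<close>, evaluated at the formal integer combination \<open>t\<close>; the target group is
  written multiplicatively.\<close>

definition lin_ext :: "('a, 'n) monoid_scheme \<Rightarrow> ('l \<Rightarrow> 'a) \<Rightarrow> ('l \<Rightarrow>\<^sub>0 int) \<Rightarrow> 'a" where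
  "lin_ext G g t = (\<Otimes>\<^bsub>G\<^esub>l\<in>Poly_Mapping.keys t. g l [^]\<^bsub>G\<^esub> Poly_Mapping.lookup t l)"

lemma shift_act_eq_lin_ext: "shift_act \<Lambda> A t f x = lin_ext A (\<lambda>l. f (x \<otimes>\<^bsub>\<Lambda>\<^esub> l)) t"
  by (simp add: shift_act_def lin_ext_def)

context comm_group
begin

text \<open>The product may be taken over any finite set containing the support, which lets two
  combinations with different supports be compared.\<close>

lemma lin_ext_eq_finprod:
  assumes "finite B" "Poly_Mapping.keys t \<subseteq> B" "g \<in> B \<rightarrow> carrier G"
  shows "lin_ext G g t = (\<Otimes>l\<in>B. g l [^] Poly_Mapping.lookup t l)"
  unfolding lin_ext_def using assms
  by (intro finprod_mono_neutral_cong_left) (auto simp: in_keys_iff)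

lemma lin_ext_closed:
  assumes "g \<in> S \<rightarrow> carrier G" "Poly_Mapping.keys t \<subseteq> S"
  shows "lin_ext G g t \<in> carrier G"
  unfolding lin_ext_def using assms by (intro finprod_closed) auto

lemma lin_ext_add:
  assumes g: "g \<in> S \<rightarrow> carrier G" and s: "Poly_Mapping.keys s \<subseteq> S" and t: "Poly_Mapping.keys t \<subseteq> S"
  shows "lin_ext G g (s + t) = lin_ext G g s \<otimes> lin_ext G g t"
proof -
  let ?B = "Poly_Mapping.keys s \<union> Poly_Mapping.keys t"
  have gB: "g \<in> ?B \<rightarrow> carrier G"
    using assms by auto
  have "lin_ext G g (s + t) = (\<Otimes>l\<in>?B. g l [^] Poly_Mapping.lookup (s + t) l)"
    using keys_add[of s t] gB by (intro lin_ext_eq_finprod) auto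
  also have "\<dots> = (\<Otimes>l\<in>?B. g l [^] Poly_Mapping.lookup s l \<otimes> g l [^] Poly_Mapping.lookup t l)"
    using gB by (intro finprod_cong') (auto simp: lookup_add int_pow_mult Pi_iff)
  also have "\<dots> = (\<Otimes>l\<in>?B. g l [^] Poly_Mapping.lookup s l) \<otimes> (\<Otimes>l\<in>?B. g l [^] Poly_Mapping.lookup t l)"
    using gB by (intro finprod_multf) auto
  also have "\<dots> = lin_ext G g s \<otimes> lin_ext G g t"
    using gB by (simp add: lin_ext_eq_finprod[of ?B])
  finally show ?thesis .
qed

lemma lin_ext_hom:
  assumes "g \<in> S \<rightarrow> carrier G"
  shows "lin_ext G g \<in> hom (free_Abelian_group S) G"
  using assms by (intro homI) (auto simp: lin_ext_closed lin_ext_add)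

lemma lin_ext_0 [simp]: "lin_ext G g 0 = \<one>"
  by (simp add: lin_ext_def)

lemma lin_ext_diff:
  assumes g: "g \<in> S \<rightarrow> carrier G" and s: "Poly_Mapping.keys s \<subseteq> S" and t: "Poly_Mapping.keys t \<subseteq> S"
  shows "lin_ext G g (s - t) = lin_ext G g s \<otimes> inv (lin_ext G g t)"
proof -
  have st: "Poly_Mapping.keys (s - t) \<subseteq> S"
    using keys_diff[of s t] s t by auto
  have "lin_ext G g s = lin_ext G g (s - t) \<otimes> lin_ext G g t"
    using lin_ext_add[OF g st t] by simp
  then show ?thesis
    using lin_ext_closed[OF g] s t st by (simp add: inv_solve_right)
qed

lemma lin_ext_of:
  assumes "g l \<in> carrier G"
  shows "lin_ext G g (frag_of l) = g l"
  using assms by (simp add: lin_ext_def)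

lemma lin_ext_cong:
  assumes "\<And>l. l \<in> S \<Longrightarrow> g l = g' l" "g' \<in> S \<rightarrow> carrier G" "Poly_Mapping.keys t \<subseteq> S"
  shows "lin_ext G g t = lin_ext G g' t"
  unfolding lin_ext_def using assms by (intro finprod_cong') (auto simp: Pi_iff subset_iff)

text \<open>Linear extension is natural in the target group.\<close>

lemma hom_lin_ext:
  assumes H: "comm_group H" and h: "h \<in> hom G H"
    and g: "g \<in> S \<rightarrow> carrier G" and t: "Poly_Mapping.keys t \<subseteq> S"
  shows "h (lin_ext G g t) = lin_ext H (\<lambda>l. h (g l)) t"
proof -
  interpret H: comm_group H by fact
  interpret h: group_hom G H h
    by unfold_locales (rule h)
  have hg: "(\<lambda>l. h (g l)) \<in> S \<rightarrow> carrier H"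
    using g hom_in_carrier[OF h] by (auto simp: Pi_iff)
  show ?thesis
    using t
  proof (induction t rule: free_Abelian_group_induct[consumes 1, case_names zero diff single])
    case (diff s t)
    then show ?case
      using lin_ext_closed[OF g] by (simp add: lin_ext_diff[OF g] H.lin_ext_diff[OF hg])
  next
    case (single l)
    then show ?case
      using g hg by (auto simp: lin_ext_of H.lin_ext_of Pi_iff)
  qed simp
qed

text \<open>Linear extension commutes with substituting formal combinations \<open>b p\<close> for the generators \<open>p\<close>; since
  the product of the group ring is such a substitution, this governs how products act.\<close>

lemma lin_ext_frag_extend:
  assumes g: "g \<in> T \<rightarrow> carrier G" and b: "\<And>p. p \<in> S \<Longrightarrow> Poly_Mapping.keys (b p) \<subseteq> T"
    and s: "Poly_Mapping.keys s \<subseteq> S"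
  shows "lin_ext G g (frag_extend b s) = lin_ext G (\<lambda>p. lin_ext G g (b p)) s"
proof -
  have gb: "(\<lambda>p. lin_ext G g (b p)) \<in> S \<rightarrow> carrier G"
    using lin_ext_closed[OF g] b by auto
  have keys: "Poly_Mapping.keys (frag_extend b u) \<subseteq> T" if "Poly_Mapping.keys u \<subseteq> S" for u
    using keys_frag_extend[of b u] b that by blast
  show ?thesis
    using s
  proof (induction s rule: free_Abelian_group_induct[consumes 1, case_names zero diff single])
    case (diff s t)
    then show ?case
      by (simp add: frag_extend_diff lin_ext_diff[OF g] lin_ext_diff[OF gb] keys)
  next
    case (single l)
    then show ?case
      using gb by (auto simp: lin_ext_of Pi_iff)
  qed simp
qed

end

section \<open>The group ring\<close>

lemma carrier_Sh [simp]: "t \<in> carrier (Sh \<Lambda>) \<longleftrightarrow> Poly_Mapping.keys t \<subseteq> carrier \<Lambda>"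
  and zero_Sh [simp]: "\<zero>\<^bsub>Sh \<Lambda>\<^esub> = 0"
  and one_Sh [simp]: "\<one>\<^bsub>Sh \<Lambda>\<^esub> = frag_of \<one>\<^bsub>\<Lambda>\<^esub>"
  and add_Sh [simp]: "s \<oplus>\<^bsub>Sh \<Lambda>\<^esub> t = s + t"
  by (simp_all add: Sh_def)

lemma mult_Sh:
  "s \<otimes>\<^bsub>Sh \<Lambda>\<^esub> t = frag_extend (\<lambda>p. frag_extend (\<lambda>q. frag_of (p \<otimes>\<^bsub>\<Lambda>\<^esub> q)) t) s"
  by (simp add: Sh_def)

lemma add_monoid_Sh: "add_monoid (Sh \<Lambda>) = free_Abelian_group (carrier \<Lambda>)"
  by (simp add: Sh_def free_Abelian_group_def)

lemma mult_Sh_of [simp]: "frag_of p \<otimes>\<^bsub>Sh \<Lambda>\<^esub> frag_of q = frag_of (p \<otimes>\<^bsub>\<Lambda>\<^esub> q)"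
  by (simp add: mult_Sh)

lemma mult_Sh_0_left: "0 \<otimes>\<^bsub>Sh \<Lambda>\<^esub> t = 0"
  and mult_Sh_diff_left: "(s - s') \<otimes>\<^bsub>Sh \<Lambda>\<^esub> t = s \<otimes>\<^bsub>Sh \<Lambda>\<^esub> t - s' \<otimes>\<^bsub>Sh \<Lambda>\<^esub> t"
  and mult_Sh_add_left: "(s + s') \<otimes>\<^bsub>Sh \<Lambda>\<^esub> t = s \<otimes>\<^bsub>Sh \<Lambda>\<^esub> t + s' \<otimes>\<^bsub>Sh \<Lambda>\<^esub> t"
  by (simp_all add: mult_Sh frag_extend_diff frag_extend_add)

lemma mult_Sh_0_right: "s \<otimes>\<^bsub>Sh \<Lambda>\<^esub> 0 = 0"
  by (simp add: mult_Sh frag_extend_eq_0)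

lemma mult_Sh_diff_right: "s \<otimes>\<^bsub>Sh \<Lambda>\<^esub> (t - t') = s \<otimes>\<^bsub>Sh \<Lambda>\<^esub> t - s \<otimes>\<^bsub>Sh \<Lambda>\<^esub> t'"
proof (induction s rule: frag_induction[OF subset_UNIV])
  case (2 p)
  then show ?case
    by (simp add: mult_Sh frag_extend_diff)
qed (simp_all add: mult_Sh_0_left mult_Sh_diff_left)

text \<open>With these rules, induction on formal combinations reduces the ring laws of the group ring to
  the laws of the group.\<close>

lemmas mult_Sh_bilinear =
  mult_Sh_0_left mult_Sh_diff_left mult_Sh_0_right mult_Sh_diff_right

lemma keys_mult_Sh:
  assumes "comm_group \<Lambda>" "Poly_Mapping.keys s \<subseteq> carrier \<Lambda>" "Poly_Mapping.keys t \<subseteq> carrier \<Lambda>"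
  shows "Poly_Mapping.keys (s \<otimes>\<^bsub>Sh \<Lambda>\<^esub> t) \<subseteq> carrier \<Lambda>"
proof -
  interpret comm_group \<Lambda> by fact
  have "Poly_Mapping.keys (frag_extend (\<lambda>q. frag_of (p \<otimes>\<^bsub>\<Lambda>\<^esub> q)) t) \<subseteq> carrier \<Lambda>"
    if p: "p \<in> carrier \<Lambda>" for p
  proof -
    have "Poly_Mapping.keys (frag_extend (\<lambda>q. frag_of (p \<otimes>\<^bsub>\<Lambda>\<^esub> q)) t)
        \<subseteq> (\<Union>q\<in>Poly_Mapping.keys t. {p \<otimes>\<^bsub>\<Lambda>\<^esub> q})"
      using keys_frag_extend[of "\<lambda>q. frag_of (p \<otimes>\<^bsub>\<Lambda>\<^esub> q)" t] by simp
    also have "\<dots> \<subseteq> carrier \<Lambda>"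
      using assms(3) p by auto
    finally show ?thesis .
  qed
  then have "(\<Union>p\<in>Poly_Mapping.keys s. Poly_Mapping.keys (frag_extend (\<lambda>q. frag_of (p \<otimes>\<^bsub>\<Lambda>\<^esub> q)) t))
      \<subseteq> carrier \<Lambda>"
    using assms(2) by auto
  then show ?thesis
    unfolding mult_Sh by (rule order_trans[OF keys_frag_extend])
qed

lemma mult_Sh_assoc:
  assumes "comm_group \<Lambda>" "Poly_Mapping.keys s \<subseteq> carrier \<Lambda>" "Poly_Mapping.keys t \<subseteq> carrier \<Lambda>"
    "Poly_Mapping.keys u \<subseteq> carrier \<Lambda>"
  shows "(s \<otimes>\<^bsub>Sh \<Lambda>\<^esub> t) \<otimes>\<^bsub>Sh \<Lambda>\<^esub> u = s \<otimes>\<^bsub>Sh \<Lambda>\<^esub> (t \<otimes>\<^bsub>Sh \<Lambda>\<^esub> u)"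
proof -
  interpret comm_group \<Lambda> by fact
  show ?thesis
    using assms(2)
  proof (induction s rule: frag_induction)
    case (one p)
    show ?case
      using assms(3)
    proof (induction t rule: frag_induction)
      case (one q)
      show ?case
        using assms(4)
      proof (induction u rule: frag_induction)
        case (one r)
        then show ?case
          using \<open>p \<in> carrier \<Lambda>\<close> \<open>q \<in> carrier \<Lambda>\<close> by (simp add: m_assoc)
      qed (simp_all add: mult_Sh_bilinear)
    qed (simp_all add: mult_Sh_bilinear)
  qed (simp_all add: mult_Sh_bilinear)
qed

lemma mult_Sh_comm:
  assumes "comm_group \<Lambda>" "Poly_Mapping.keys s \<subseteq> carrier \<Lambda>" "Poly_Mapping.keys t \<subseteq> carrier \<Lambda>"
  shows "s \<otimes>\<^bsub>Sh \<Lambda>\<^esub> t = t \<otimes>\<^bsub>Sh \<Lambda>\<^esub> s"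
proof -
  interpret comm_group \<Lambda> by fact
  show ?thesis
    using assms(2)
  proof (induction s rule: frag_induction)
    case (one p)
    show ?case
      using assms(3)
    proof (induction t rule: frag_induction)
      case (one q)
      then show ?case
        using \<open>p \<in> carrier \<Lambda>\<close> by (simp add: m_comm)
    qed (simp_all add: mult_Sh_bilinear)
  qed (simp_all add: mult_Sh_bilinear)
qed

lemma mult_Sh_one:
  assumes "comm_group \<Lambda>" "Poly_Mapping.keys t \<subseteq> carrier \<Lambda>"
  shows "frag_of \<one>\<^bsub>\<Lambda>\<^esub> \<otimes>\<^bsub>Sh \<Lambda>\<^esub> t = t"
proof -
  interpret comm_group \<Lambda> by fact
  show ?thesis
    using assms(2) by (induction t rule: frag_induction) (simp_all add: mult_Sh_bilinear)
qed

lemma cring_Sh: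
  assumes "comm_group \<Lambda>"
  shows "cring (Sh \<Lambda>)"
proof (rule cringI)
  show "abelian_group (Sh \<Lambda>)"
    by (rule comm_group_abelian_groupI, unfold add_monoid_Sh) (rule abelian_free_Abelian_group)
  show "comm_monoid (Sh \<Lambda>)"
  proof (rule comm_monoidI)
    interpret comm_group \<Lambda> by fact
    show "\<one>\<^bsub>Sh \<Lambda>\<^esub> \<in> carrier (Sh \<Lambda>)" by simp
    show "s \<otimes>\<^bsub>Sh \<Lambda>\<^esub> t = t \<otimes>\<^bsub>Sh \<Lambda>\<^esub> s" if "s \<in> carrier (Sh \<Lambda>)" "t \<in> carrier (Sh \<Lambda>)" for s t
      using that by (intro mult_Sh_comm[OF assms]) auto
  qed (use assms in \<open>simp_all add: keys_mult_Sh mult_Sh_assoc mult_Sh_one\<close>)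
qed (simp add: mult_Sh_add_left)

section \<open>The action by shifts\<close>

context
  fixes \<Lambda> :: "('l, 'm) monoid_scheme" and A :: "('a, 'n) monoid_scheme" and f :: "'l \<Rightarrow> 'a"
  assumes \<Lambda>: "comm_group \<Lambda>" and A: "comm_group A" and f: "f \<in> carrier \<Lambda> \<rightarrow> carrier A"
begin

interpretation \<Lambda>: comm_group \<Lambda> by (rule \<Lambda>)
interpretation A: comm_group A by (rule A)

lemma shifted_closed:
  assumes "x \<in> carrier \<Lambda>"
  shows "(\<lambda>l. f (x \<otimes>\<^bsub>\<Lambda>\<^esub> l)) \<in> carrier \<Lambda> \<rightarrow> carrier A"
  using f assms by auto

lemma shift_act_closed:
  "x \<in> carrier \<Lambda> \<Longrightarrow> Poly_Mapping.keys t \<subseteq> carrier \<Lambda> \<Longrightarrow> shift_act \<Lambda> A t f x \<in> carrier A"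
  unfolding shift_act_eq_lin_ext using A.lin_ext_closed[OF shifted_closed] .

lemma shift_act_hom:
  assumes "x \<in> carrier \<Lambda>"
  shows "(\<lambda>t. shift_act \<Lambda> A t f x) \<in> hom (add_monoid (Sh \<Lambda>)) A"
  unfolding shift_act_eq_lin_ext add_monoid_Sh using A.lin_ext_hom[OF shifted_closed[OF assms]] .

text \<open>The group ring acts: shifting by a product is shifting twice.\<close>

lemma shift_act_mult:
  assumes x: "x \<in> carrier \<Lambda>" and s: "Poly_Mapping.keys s \<subseteq> carrier \<Lambda>"
    and t: "Poly_Mapping.keys t \<subseteq> carrier \<Lambda>"
  shows "shift_act \<Lambda> A (s \<otimes>\<^bsub>Sh \<Lambda>\<^esub> t) f x = shift_act \<Lambda> A s (shift_act \<Lambda> A t f) x"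
proof -
  have inner: "lin_ext A (\<lambda>l. f (x \<otimes>\<^bsub>\<Lambda>\<^esub> l)) (frag_extend (\<lambda>q. frag_of (p \<otimes>\<^bsub>\<Lambda>\<^esub> q)) t)
      = shift_act \<Lambda> A t f (x \<otimes>\<^bsub>\<Lambda>\<^esub> p)" if p: "p \<in> carrier \<Lambda>" for p
  proof -
    have "lin_ext A (\<lambda>l. f (x \<otimes>\<^bsub>\<Lambda>\<^esub> l)) (frag_extend (\<lambda>q. frag_of (p \<otimes>\<^bsub>\<Lambda>\<^esub> q)) t)
        = lin_ext A (\<lambda>q. lin_ext A (\<lambda>l. f (x \<otimes>\<^bsub>\<Lambda>\<^esub> l)) (frag_of (p \<otimes>\<^bsub>\<Lambda>\<^esub> q))) t"
      using p t by (intro A.lin_ext_frag_extend[OF shifted_closed[OF x]]) auto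
    also have "\<dots> = shift_act \<Lambda> A t f (x \<otimes>\<^bsub>\<Lambda>\<^esub> p)"
      unfolding shift_act_eq_lin_ext
      using p t x f by (intro A.lin_ext_cong[where S = "carrier \<Lambda>"])
        (auto simp: A.lin_ext_of \<Lambda>.m_assoc Pi_iff)
    finally show ?thesis .
  qed
  have keys: "Poly_Mapping.keys (frag_extend (\<lambda>q. frag_of (p \<otimes>\<^bsub>\<Lambda>\<^esub> q)) t) \<subseteq> carrier \<Lambda>"
    if "p \<in> carrier \<Lambda>" for p
    using keys_mult_Sh[OF \<Lambda>, of "frag_of p" t] that t by (simp add: mult_Sh)
  have "shift_act \<Lambda> A (s \<otimes>\<^bsub>Sh \<Lambda>\<^esub> t) f x = lin_ext A (\<lambda>p. lin_ext A (\<lambda>l. f (x \<otimes>\<^bsub>\<Lambda>\<^esub> l))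
      (frag_extend (\<lambda>q. frag_of (p \<otimes>\<^bsub>\<Lambda>\<^esub> q)) t)) s"
    unfolding shift_act_eq_lin_ext mult_Sh
    using keys s by (intro A.lin_ext_frag_extend[OF shifted_closed[OF x]]) auto
  also have "\<dots> = lin_ext A (\<lambda>p. shift_act \<Lambda> A t f (x \<otimes>\<^bsub>\<Lambda>\<^esub> p)) s"
    using inner s t x by (intro A.lin_ext_cong[where S = "carrier \<Lambda>"]) (auto intro: shift_act_closed)
  finally show ?thesis
    by (simp add: shift_act_eq_lin_ext[of \<Lambda> A s])
qed

lemma shift_act_0:
  assumes "\<And>x. x \<in> carrier \<Lambda> \<Longrightarrow> g x = \<one>\<^bsub>A\<^esub>"
    and "x \<in> carrier \<Lambda>" "Poly_Mapping.keys t \<subseteq> carrier \<Lambda>"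
  shows "shift_act \<Lambda> A t g x = \<one>\<^bsub>A\<^esub>"
  unfolding shift_act_def using assms by (intro A.finprod_one_eqI) (auto simp: subset_iff)

lemma ideal_Ann: "ideal (Ann \<Lambda> A f) (Sh \<Lambda>)"
proof -
  interpret Sh: cring "Sh \<Lambda>" by (rule cring_Sh[OF \<Lambda>])
  have closed: "s \<otimes>\<^bsub>Sh \<Lambda>\<^esub> t \<in> Ann \<Lambda> A f" if "t \<in> Ann \<Lambda> A f" "s \<in> carrier (Sh \<Lambda>)" for s t
    using that by (auto simp: Ann_def shift_act_mult shift_act_0 keys_mult_Sh[OF \<Lambda>])
  show ?thesis
  proof (rule idealI)
    have hom: "group_hom (add_monoid (Sh \<Lambda>)) A (\<lambda>t. shift_act \<Lambda> A t f x)" if "x \<in> carrier \<Lambda>" for x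
      using shift_act_hom[OF that] Sh.a_group A.is_group unfolding group_hom_def group_hom_axioms_def by blast
    show "subgroup (Ann \<Lambda> A f) (add_monoid (Sh \<Lambda>))"
    proof (rule group.subgroupI[OF Sh.a_group])
      show "Ann \<Lambda> A f \<noteq> {}"
        using group_hom.hom_one[OF hom] by (auto simp: Ann_def intro!: exI[of _ 0])
      show "inv\<^bsub>add_monoid (Sh \<Lambda>)\<^esub> t \<in> Ann \<Lambda> A f" if "t \<in> Ann \<Lambda> A f" for t
      proof -
        have "inv\<^bsub>add_monoid (Sh \<Lambda>)\<^esub> t = - t"
          using that unfolding add_monoid_Sh by (simp add: Ann_def)
        then show ?thesis
          using that group_hom.hom_inv[OF hom, of _ t] by (auto simp: Ann_def)
      qed
      show "s \<otimes>\<^bsub>add_monoid (Sh \<Lambda>)\<^esub> t \<in> Ann \<Lambda> A f" if "s \<in> Ann \<Lambda> A f" "t \<in> Ann \<Lambda> A f" for s t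
        using that group_hom.hom_mult[OF hom, of _ s t] Sh.a_closed[of s t] by (auto simp: Ann_def)
    qed (auto simp: Ann_def)
    show "t \<otimes>\<^bsub>Sh \<Lambda>\<^esub> s \<in> Ann \<Lambda> A f" if "t \<in> Ann \<Lambda> A f" "s \<in> carrier (Sh \<Lambda>)" for s t
      using closed[OF that] that Sh.m_comm[of s t] by (auto simp: Ann_def)
  qed (use closed Sh.ring_axioms in auto)
qed

text \<open>Multiplying by a lattice element and applying the functional recovers each value of \<open>t \<cdot> f\<close>; this
  is the source of non-degeneracy.\<close>

lemma ell_mult_of:
  assumes t: "Poly_Mapping.keys t \<subseteq> carrier \<Lambda>" and x: "x \<in> carrier \<Lambda>"
  shows "ell \<Lambda> A f (t \<otimes>\<^bsub>Sh \<Lambda>\<^esub> frag_of x) = shift_act \<Lambda> A t f x"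
proof -
  have "t \<otimes>\<^bsub>Sh \<Lambda>\<^esub> frag_of x = frag_of x \<otimes>\<^bsub>Sh \<Lambda>\<^esub> t"
    using t x by (intro mult_Sh_comm[OF \<Lambda>]) auto
  then have "ell \<Lambda> A f (t \<otimes>\<^bsub>Sh \<Lambda>\<^esub> frag_of x) = shift_act \<Lambda> A (frag_of x) (shift_act \<Lambda> A t f) \<one>\<^bsub>\<Lambda>\<^esub>"
    using t x by (simp add: ell_def shift_act_mult)
  also have "\<dots> = shift_act \<Lambda> A t f x"
    using t x by (subst shift_act_eq_lin_ext) (simp add: A.lin_ext_of shift_act_closed)
  finally show ?thesis .
qed

lemma frobenius_duality_K_quot:
  "\<exists>L. (\<forall>t\<in>carrier (Sh \<Lambda>). L (Ann \<Lambda> A f +>\<^bsub>Sh \<Lambda>\<^esub> t) = ell \<Lambda> A f t) \<and>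
     frobenius_duality (K_quot \<Lambda> A f) A L"
proof -
  let ?I = "Ann \<Lambda> A f"
  interpret Sh: cring "Sh \<Lambda>" by (rule cring_Sh[OF \<Lambda>])
  interpret I: ideal ?I "Sh \<Lambda>" by (rule ideal_Ann)
  have ell_hom: "ell \<Lambda> A f \<in> hom (add_monoid (Sh \<Lambda>)) A"
    using shift_act_hom[OF \<Lambda>.one_closed] by (simp add: ell_def[abs_def])
  \<comment> \<open>The functional is constant on cosets of the annihilator, so its image on a coset is a singleton.\<close>
  define L where "L C = the_elem (ell \<Lambda> A f ` C)" for C
  have L: "L (?I +>\<^bsub>Sh \<Lambda>\<^esub> t) = ell \<Lambda> A f t" if t: "t \<in> carrier (Sh \<Lambda>)" for t
  proof -
    have "ell \<Lambda> A f u = ell \<Lambda> A f t" if "u \<in> ?I +>\<^bsub>Sh \<Lambda>\<^esub> t" for u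
    proof -
      obtain i where i: "i \<in> ?I" "u = i + t"
        using \<open>u \<in> _\<close> by (auto simp: a_r_coset_def')
      then have "i \<in> carrier (Sh \<Lambda>)" "ell \<Lambda> A f i = \<one>\<^bsub>A\<^esub>"
        by (auto simp: Ann_def ell_def)
      then show ?thesis
        using hom_mult[OF ell_hom, of i t] hom_in_carrier[OF ell_hom, of t] t i by simp
    qed
    then have "ell \<Lambda> A f ` (?I +>\<^bsub>Sh \<Lambda>\<^esub> t) = {ell \<Lambda> A f t}"
      using I.a_rcos_self[OF t] by blast
    then show ?thesis
      by (simp add: L_def)
  qed
  have carr: "\<exists>t\<in>carrier (Sh \<Lambda>). C = ?I +>\<^bsub>Sh \<Lambda>\<^esub> t" if "C \<in> carrier (K_quot \<Lambda> A f)" for C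
    using that by (auto simp: K_quot_def FactRing_def A_RCOSETS_def')
  have coset: "?I +>\<^bsub>Sh \<Lambda>\<^esub> t \<in> carrier (K_quot \<Lambda> A f)" if "t \<in> carrier (Sh \<Lambda>)" for t
    using that by (auto simp: K_quot_def FactRing_def A_RCOSETS_def')
  have "frobenius_duality (K_quot \<Lambda> A f) A L"
    unfolding frobenius_duality_def
  proof (intro conjI ballI impI)
    show "cring (K_quot \<Lambda> A f)"
      unfolding K_quot_def by (rule I.quotient_is_cring[OF Sh.cring_axioms])
    show "L \<in> hom (add_monoid (K_quot \<Lambda> A f)) A"
    proof (rule homI)
      fix C assume "C \<in> carrier (add_monoid (K_quot \<Lambda> A f))"
      then obtain t where t: "t \<in> carrier (Sh \<Lambda>)" and C: "C = ?I +>\<^bsub>Sh \<Lambda>\<^esub> t"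
        using carr[of C] by auto
      show "L C \<in> carrier A"
        using L[OF t] hom_in_carrier[OF ell_hom, of t] t C by simp
      fix D assume "D \<in> carrier (add_monoid (K_quot \<Lambda> A f))"
      then obtain u where u: "u \<in> carrier (Sh \<Lambda>)" and D: "D = ?I +>\<^bsub>Sh \<Lambda>\<^esub> u"
        using carr[of D] by auto
      have "C \<otimes>\<^bsub>add_monoid (K_quot \<Lambda> A f)\<^esub> D = ?I +>\<^bsub>Sh \<Lambda>\<^esub> (t \<oplus>\<^bsub>Sh \<Lambda>\<^esub> u)"
        using I.a_rcos_sum[OF t u] by (simp add: C D K_quot_def FactRing_def)
      then have "L (C \<otimes>\<^bsub>add_monoid (K_quot \<Lambda> A f)\<^esub> D) = ell \<Lambda> A f (t \<oplus>\<^bsub>Sh \<Lambda>\<^esub> u)"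
        using L[OF Sh.a_closed[OF t u]] by (simp only:)
      also have "\<dots> = L C \<otimes>\<^bsub>A\<^esub> L D"
        using hom_mult[OF ell_hom, of t u] t u by (simp add: C D L)
      finally show "L (C \<otimes>\<^bsub>add_monoid (K_quot \<Lambda> A f)\<^esub> D) = L C \<otimes>\<^bsub>A\<^esub> L D" .
    qed
    fix C assume C: "C \<in> carrier (K_quot \<Lambda> A f)" "C \<noteq> \<zero>\<^bsub>K_quot \<Lambda> A f\<^esub>"
    from carr[OF C(1)] obtain t where t: "t \<in> carrier (Sh \<Lambda>)" "C = ?I +>\<^bsub>Sh \<Lambda>\<^esub> t"
      by blast
    have "t \<notin> ?I"
      using C(2) t I.a_rcos_const[of t] by (auto simp: K_quot_def FactRing_def)
    then obtain x where x: "x \<in> carrier \<Lambda>" "shift_act \<Lambda> A t f x \<noteq> \<one>\<^bsub>A\<^esub>"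
      using t by (auto simp: Ann_def)
    have "C \<otimes>\<^bsub>K_quot \<Lambda> A f\<^esub> (?I +>\<^bsub>Sh \<Lambda>\<^esub> frag_of x) = ?I +>\<^bsub>Sh \<Lambda>\<^esub> (t \<otimes>\<^bsub>Sh \<Lambda>\<^esub> frag_of x)"
      using t x I.rcoset_mult_add[of t "frag_of x"] by (simp add: K_quot_def FactRing_def)
    then have "L (C \<otimes>\<^bsub>K_quot \<Lambda> A f\<^esub> (?I +>\<^bsub>Sh \<Lambda>\<^esub> frag_of x)) = shift_act \<Lambda> A t f x"
      using t x L[of "t \<otimes>\<^bsub>Sh \<Lambda>\<^esub> frag_of x"] Sh.m_closed[of t "frag_of x"] by (simp add: ell_mult_of)
    then show "\<exists>D\<in>carrier (K_quot \<Lambda> A f). L (C \<otimes>\<^bsub>K_quot \<Lambda> A f\<^esub> D) \<noteq> \<one>\<^bsub>A\<^esub>"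
      using x coset[of "frag_of x"] by (intro bexI[of _ "?I +>\<^bsub>Sh \<Lambda>\<^esub> frag_of x"]) auto
  qed (rule A)
  with L show ?thesis
    by blast
qed

end

section \<open>Rings generated by invertible elements\<close>

text \<open>Integer powers of a unit can be computed in the group of units, where the laws of
  exponents for groups apply.\<close>

lemma (in monoid) int_pow_units_of:
  assumes "u \<in> Units G"
  shows "u [^]\<^bsub>units_of G\<^esub> (n :: int) = u [^] n"
proof -
  interpret U: group "units_of G" by (rule units_group)
  have "u [^]\<^bsub>units_of G\<^esub> (k :: nat) = u [^] k" for k
    by (simp add: nat_pow_def units_of_mult units_of_one)
  moreover have "u [^]\<^bsub>units_of G\<^esub> (k :: nat) \<in> Units G" for k
    using U.nat_pow_closed assms by (simp add: units_of_carrier)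
  ultimately show ?thesis
    by (simp add: int_pow_def2 units_of_inv del: pow_nat)
qed

text \<open>The monomial \<open>\<Prod>\<^sub>i a\<^sub>i ^ n\<^sub>i\<close> with integer exponents, over an arbitrary index set \<open>I\<close>. It is meaningful when
  \<open>I\<close> is finite and every \<open>a\<^sub>i\<close> is a unit; entries of \<open>n\<close> outside \<open>I\<close> are ignored.\<close>

definition laurent_monomial ::
  "('r, 'k) ring_scheme \<Rightarrow> 'i set \<Rightarrow> ('i \<Rightarrow> 'r) \<Rightarrow> ('i \<Rightarrow>\<^sub>0 int) \<Rightarrow> 'r" where
  "laurent_monomial R I a n = (\<Otimes>\<^bsub>R\<^esub>i\<in>I. a i [^]\<^bsub>R\<^esub> Poly_Mapping.lookup n i)"

context
  fixes R :: "('r, 'k) ring_scheme" and I :: "'i set" and a :: "'i \<Rightarrow> 'r"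
  assumes R: "cring R" and I: "finite I" and units: "\<forall>i\<in>I. a i \<in> Units R"
begin

interpretation R: cring R by (rule R)
interpretation U: comm_group "units_of R" by (rule R.units_comm_group)

lemma unit_pow_closed:
  assumes "i \<in> I"
  shows "a i [^]\<^bsub>R\<^esub> (n :: int) \<in> carrier R"
  using U.int_pow_closed[of "a i" n] assms units
  by (simp add: units_of_carrier R.int_pow_units_of R.Units_closed)

lemma laurent_monomial_closed: "laurent_monomial R I a n \<in> carrier R"
  unfolding laurent_monomial_def by (intro R.finprod_closed) (auto simp: unit_pow_closed)

lemma laurent_monomial_0: "laurent_monomial R I a 0 = \<one>\<^bsub>R\<^esub>"
  unfolding laurent_monomial_def by (simp add: R.finprod_one_eqI)

lemma laurent_monomial_add:
  "laurent_monomial R I a (m + n) = laurent_monomial R I a m \<otimes>\<^bsub>R\<^esub> laurent_monomial R I a n"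
proof -
  have "a i [^]\<^bsub>R\<^esub> (j + k) = a i [^]\<^bsub>R\<^esub> j \<otimes>\<^bsub>R\<^esub> a i [^]\<^bsub>R\<^esub> k" if "i \<in> I" for i and j k :: int
    using U.int_pow_mult[of "a i" j k] that units
    by (simp add: units_of_carrier units_of_mult R.int_pow_units_of)
  then have "laurent_monomial R I a (m + n) = (\<Otimes>\<^bsub>R\<^esub>i\<in>I. a i [^]\<^bsub>R\<^esub> Poly_Mapping.lookup m i
      \<otimes>\<^bsub>R\<^esub> a i [^]\<^bsub>R\<^esub> Poly_Mapping.lookup n i)"
    unfolding laurent_monomial_def
    by (intro R.finprod_cong') (auto simp: lookup_add unit_pow_closed)
  also have "\<dots> = laurent_monomial R I a m \<otimes>\<^bsub>R\<^esub> laurent_monomial R I a n"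
    unfolding laurent_monomial_def by (intro R.finprod_multf) (auto simp: unit_pow_closed)
  finally show ?thesis .
qed

lemma laurent_monomial_of:
  assumes "i \<in> I"
  shows "laurent_monomial R I a (frag_of i) = a i"
proof -
  have ai: "a i \<in> carrier R" "a i \<in> Units R"
    using assms units by auto
  have "a i [^]\<^bsub>R\<^esub> (1 :: int) = a i"
    using U.int_pow_1[of "a i"] ai by (simp add: units_of_carrier R.int_pow_units_of)
  then have "laurent_monomial R I a (frag_of i) = (\<Otimes>\<^bsub>R\<^esub>j\<in>I. if i = j then a j else \<one>\<^bsub>R\<^esub>)"
    unfolding laurent_monomial_def using ai units
    by (intro R.finprod_cong') auto
  also have "\<dots> = a i"
    using assms units by (intro R.finprod_singleton) (auto simp: I)
  finally show ?thesis .
qed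

text \<open>Evaluation of a formal combination of exponent vectors, that is of a Laurent polynomial, at
  the units \<open>a\<^sub>i\<close>. The linear extension is taken in the additive group of \<open>R\<close>. Since Laurent monomials
  ignore entries outside \<open>I\<close>, no restriction on the supports is needed in the algebraic laws
  below.\<close>

definition monomial_eval :: "(('i \<Rightarrow>\<^sub>0 int) \<Rightarrow>\<^sub>0 int) \<Rightarrow> 'r" where
  "monomial_eval t = lin_ext (add_monoid R) (laurent_monomial R I a) t"

lemma laurent_monomial_funcset: "laurent_monomial R I a \<in> S \<rightarrow> carrier (add_monoid R)"
  by (simp add: laurent_monomial_closed)

lemma monomial_eval_closed: "monomial_eval t \<in> carrier R"
  using comm_group.lin_ext_closed[OF R.a_comm_group laurent_monomial_funcset subset_UNIV] by (simp add: monomial_eval_def)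

lemma monomial_eval_of: "monomial_eval (frag_of n) = laurent_monomial R I a n"
  by (simp add: monomial_eval_def comm_group.lin_ext_of[OF R.a_comm_group] laurent_monomial_closed)

lemma monomial_eval_add: "monomial_eval (t + u) = monomial_eval t \<oplus>\<^bsub>R\<^esub> monomial_eval u"
  using comm_group.lin_ext_add[OF R.a_comm_group laurent_monomial_funcset subset_UNIV subset_UNIV]
  by (simp add: monomial_eval_def)

lemma monomial_eval_0: "monomial_eval 0 = \<zero>\<^bsub>R\<^esub>"
  using comm_group.lin_ext_0[OF R.a_comm_group] by (simp add: monomial_eval_def)

lemma monomial_eval_diff: "monomial_eval (t - u) = monomial_eval t \<ominus>\<^bsub>R\<^esub> monomial_eval u"
  using comm_group.lin_ext_diff[OF R.a_comm_group laurent_monomial_funcset subset_UNIV subset_UNIV]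
  by (simp add: monomial_eval_def a_inv_def[symmetric] a_minus_def)

lemma monomial_eval_mult:
  "monomial_eval (t \<otimes>\<^bsub>Sh (free_Abelian_group I)\<^esub> u) = monomial_eval t \<otimes>\<^bsub>R\<^esub> monomial_eval u"
proof (induction t rule: frag_induction[OF subset_UNIV])
  case (2 m)
  show ?case
  proof (induction u rule: frag_induction[OF subset_UNIV])
    case (2 n)
    show ?case
      by (simp add: monomial_eval_of laurent_monomial_add)
  next
    case (3 t u)
    then show ?case
      by (simp add: mult_Sh_bilinear monomial_eval_diff monomial_eval_closed R.ring_simprules
          a_minus_def)
  qed (simp add: mult_Sh_bilinear monomial_eval_0 monomial_eval_closed)
next
  case (3 t t')
  then show ?case
    by (simp add: mult_Sh_bilinear monomial_eval_diff monomial_eval_closed R.ring_simprules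
        a_minus_def)
qed (simp add: mult_Sh_bilinear monomial_eval_0 monomial_eval_closed)

lemma ring_hom_monomial_eval: "ring_hom_ring (Sh (free_Abelian_group I)) R monomial_eval"
proof (rule ring_hom_ringI)
  show "ring (Sh (free_Abelian_group I))"
    using cring_Sh[OF abelian_free_Abelian_group] cring.axioms(1) by blast
  show "monomial_eval \<one>\<^bsub>Sh (free_Abelian_group I)\<^esub> = \<one>\<^bsub>R\<^esub>"
    using monomial_eval_of[of 0] by (simp add: laurent_monomial_0)
qed (simp_all add: R.ring_axioms monomial_eval_closed monomial_eval_mult monomial_eval_add)

lemma monomial_eval_surj:
  assumes gen: "generate_ring R (a ` I) = carrier R"
  shows "monomial_eval ` carrier (Sh (free_Abelian_group I)) = carrier R"
proof -
  interpret h: ring_hom_ring "Sh (free_Abelian_group I)" R monomial_eval by (rule ring_hom_monomial_eval)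
  have "a ` I \<subseteq> monomial_eval ` carrier (Sh (free_Abelian_group I))"
  proof clarify
    fix i assume i: "i \<in> I"
    have "monomial_eval (frag_of (frag_of i)) = a i"
      using i by (simp add: monomial_eval_of laurent_monomial_of)
    then show "a i \<in> monomial_eval ` carrier (Sh (free_Abelian_group I))"
      using i by (intro image_eqI[of _ _ "frag_of (frag_of i)"]) auto
  qed
  then have "generate_ring R (a ` I) \<subseteq> monomial_eval ` carrier (Sh (free_Abelian_group I))"
    using units h.img_is_subring[OF h.R.carrier_is_subring]
    by (intro R.generate_ring_min_subring1) auto
  then show ?thesis
    using gen monomial_eval_closed by auto
qed

text \<open>The function \<open>\<ell> \<circ> \<chi>\<close> turns shifting by \<open>t\<close> into multiplication by the value of \<open>t\<close> in \<open>R\<close>.\<close>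

lemma shift_act_laurent_monomial:
  assumes A: "comm_group A" and L: "L \<in> hom (add_monoid R) A"
  shows "shift_act (free_Abelian_group I) A t (\<lambda>n. L (laurent_monomial R I a n)) n
    = L (laurent_monomial R I a n \<otimes>\<^bsub>R\<^esub> monomial_eval t)"
proof -
  interpret A: comm_group A by (rule A)
  let ?\<chi> = "laurent_monomial R I a"
  have L\<chi>: "(\<lambda>l. L (?\<chi> n \<otimes>\<^bsub>R\<^esub> l)) \<in> hom (add_monoid R) A"
    using hom_in_carrier[OF L] hom_mult[OF L]
    by (intro homI) (auto simp: R.r_distr laurent_monomial_closed)
  have "L (?\<chi> n \<otimes>\<^bsub>R\<^esub> monomial_eval t) = lin_ext A (\<lambda>l. L (?\<chi> n \<otimes>\<^bsub>R\<^esub> ?\<chi> l)) t"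
    unfolding monomial_eval_def
    using comm_group.hom_lin_ext[OF R.a_comm_group A L\<chi> laurent_monomial_funcset subset_UNIV] .
  also have "\<dots> = shift_act (free_Abelian_group I) A t (\<lambda>n. L (laurent_monomial R I a n)) n"
    by (simp add: shift_act_eq_lin_ext laurent_monomial_add)
  finally show ?thesis
    by simp
qed

text \<open>Non-degeneracy enters here: an element \<open>x\<close> of \<open>R\<close> is zero as soon as \<open>\<ell>(\<chi>(n) x) = 0\<close> for all \<open>n\<close>,
  because by surjectivity every \<open>y\<close> is an integer combination of monomials \<open>\<chi>(n)\<close>.\<close>

lemma kernel_monomial_eval:
  assumes gen: "generate_ring R (a ` I) = carrier R" and dual: "frobenius_duality R A L"
  shows "a_kernel (Sh (free_Abelian_group I)) R monomial_eval
    = Ann (free_Abelian_group I) A (\<lambda>n. L (laurent_monomial R I a n))"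
proof -
  have A: "comm_group A" and L: "L \<in> hom (add_monoid R) A"
    and nondeg: "\<And>x. x \<in> carrier R \<Longrightarrow> (\<And>y. y \<in> carrier R \<Longrightarrow> L (x \<otimes>\<^bsub>R\<^esub> y) = \<one>\<^bsub>A\<^esub>) \<Longrightarrow> x = \<zero>\<^bsub>R\<^esub>"
    using dual by (auto simp: frobenius_duality_def)
  interpret A: comm_group A by (rule A)
  interpret L: group_hom "add_monoid R" A L
    by unfold_locales (rule L)
  let ?\<chi> = "laurent_monomial R I a"
  have "monomial_eval t = \<zero>\<^bsub>R\<^esub>"
    if t: "\<And>n. Poly_Mapping.keys n \<subseteq> I \<Longrightarrow> L (?\<chi> n \<otimes>\<^bsub>R\<^esub> monomial_eval t) = \<one>\<^bsub>A\<^esub>" for t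
  proof (rule nondeg[OF monomial_eval_closed])
    let ?x = "monomial_eval t"
    fix y assume "y \<in> carrier R"
    then have "y \<in> monomial_eval ` carrier (Sh (free_Abelian_group I))"
      by (simp only: monomial_eval_surj[OF gen])
    then obtain u where u: "Poly_Mapping.keys u \<subseteq> carrier (free_Abelian_group I)" "y = monomial_eval u"
      by auto
    have Lx: "(\<lambda>l. L (?x \<otimes>\<^bsub>R\<^esub> l)) \<in> hom (add_monoid R) A"
      using hom_in_carrier[OF L] hom_mult[OF L]
      by (intro homI) (auto simp: R.r_distr monomial_eval_closed)
    have "L (?x \<otimes>\<^bsub>R\<^esub> y) = lin_ext A (\<lambda>l. L (?x \<otimes>\<^bsub>R\<^esub> ?\<chi> l)) u"
      unfolding u(2) monomial_eval_def[of u]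
      using comm_group.hom_lin_ext[OF R.a_comm_group A Lx laurent_monomial_funcset subset_UNIV] .
    also have "\<dots> = \<one>\<^bsub>A\<^esub>"
      unfolding lin_ext_def
    proof (rule A.finprod_one_eqI)
      fix l assume "l \<in> Poly_Mapping.keys u"
      then have "Poly_Mapping.keys l \<subseteq> I"
        using u(1) by (metis carrier_free_Abelian_group_iff subsetD)
      then show "L (?x \<otimes>\<^bsub>R\<^esub> ?\<chi> l) [^]\<^bsub>A\<^esub> Poly_Mapping.lookup u l = \<one>\<^bsub>A\<^esub>"
        using t[of l] by (simp add: R.m_comm[of ?x] monomial_eval_closed laurent_monomial_closed)
    qed
    finally show "L (?x \<otimes>\<^bsub>R\<^esub> y) = \<one>\<^bsub>A\<^esub>" .
  qed
  moreover have "L (?\<chi> n \<otimes>\<^bsub>R\<^esub> monomial_eval t) = \<one>\<^bsub>A\<^esub>" if "monomial_eval t = \<zero>\<^bsub>R\<^esub>" for n t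
    using that L.hom_one by (simp add: laurent_monomial_closed)
  ultimately have "monomial_eval t = \<zero>\<^bsub>R\<^esub> \<longleftrightarrow>
      (\<forall>n\<in>carrier (free_Abelian_group I). L (?\<chi> n \<otimes>\<^bsub>R\<^esub> monomial_eval t) = \<one>\<^bsub>A\<^esub>)" for t
    by (metis carrier_free_Abelian_group_iff)
  then show ?thesis
    by (simp add: a_kernel_def' Ann_def shift_act_laurent_monomial[OF A L])
qed

lemma ring_iso_K_quot_laurent_monomial:
  assumes gen: "generate_ring R (a ` I) = carrier R" and dual: "frobenius_duality R A L"
  shows "R \<simeq> K_quot (free_Abelian_group I) A (\<lambda>n. L (laurent_monomial R I a n))"
proof -
  interpret h: ring_hom_ring "Sh (free_Abelian_group I)" R monomial_eval by (rule ring_hom_monomial_eval)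
  have "K_quot (free_Abelian_group I) A (\<lambda>n. L (laurent_monomial R I a n)) \<simeq> R"
    using h.FactRing_iso[OF monomial_eval_surj[OF gen]]
    by (simp add: K_quot_def kernel_monomial_eval[OF gen dual])
  moreover have "ring (K_quot (free_Abelian_group I) A (\<lambda>n. L (laurent_monomial R I a n)))"
    using ideal.quotient_is_ring[OF h.kernel_is_ideal]
    by (simp add: K_quot_def kernel_monomial_eval[OF gen dual])
  ultimately show ?thesis
    by (rule ring_iso_sym[rotated])
qed

end

theorem theorem2p11:
  fixes \<Lambda> :: "('l, 'm) monoid_scheme"
    and A :: "('a, 'n) monoid_scheme"
    and R :: "('r, 'k) ring_scheme"
  assumes "comm_group A"
  shows "(\<forall>f. free_abelian_lattice \<Lambda> \<and> f \<in> carrier \<Lambda> \<rightarrow> carrier A \<longrightarrow>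
            ideal (Ann \<Lambda> A f) (Sh \<Lambda>) \<and>
            (\<exists>L. (\<forall>t\<in>carrier (Sh \<Lambda>). L (Ann \<Lambda> A f +>\<^bsub>Sh \<Lambda>\<^esub> t) = ell \<Lambda> A f t) \<and>
                 frobenius_duality (K_quot \<Lambda> A f) A L)) \<and>
         (\<forall>s (a :: nat \<Rightarrow> 'r) (L :: 'r \<Rightarrow> 'a).
            cring R \<and> (\<forall>i\<in>{1..s}. a i \<in> Units R) \<and> generate_ring R (a ` {1..s}) = carrier R \<and>
            frobenius_duality R A L \<longrightarrow>
            R \<simeq> K_quot (Zpow s) A (monomial_function R s a L))"
proof (intro conjI allI impI; elim conjE)
  fix f assume "free_abelian_lattice \<Lambda>" and f: "f \<in> carrier \<Lambda> \<rightarrow> carrier A"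
  then have \<Lambda>: "comm_group \<Lambda>"
    by (simp add: free_abelian_lattice_def)
  show "ideal (Ann \<Lambda> A f) (Sh \<Lambda>)"
    using ideal_Ann[OF \<Lambda> assms f] .
  show "\<exists>L. (\<forall>t\<in>carrier (Sh \<Lambda>). L (Ann \<Lambda> A f +>\<^bsub>Sh \<Lambda>\<^esub> t) = ell \<Lambda> A f t) \<and>
      frobenius_duality (K_quot \<Lambda> A f) A L"
    using frobenius_duality_K_quot[OF \<Lambda> assms f] .
next
  fix s and a :: "nat \<Rightarrow> 'r" and L :: "'r \<Rightarrow> 'a"
  assume "cring R" "\<forall>i\<in>{1..s}. a i \<in> Units R"
    "generate_ring R (a ` {1..s}) = carrier R" "frobenius_duality R A L"
  then have "R \<simeq> K_quot (Zpow s) A (\<lambda>n. L (laurent_monomial R {1..s} a n))"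
    by (intro ring_iso_K_quot_laurent_monomial) auto
  then show "R \<simeq> K_quot (Zpow s) A (monomial_function R s a L)"
    by (simp add: monomial_function_def[abs_def] laurent_monomial_def)
qed

end
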